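(* Let $K$ be a space equipped with a measure $\mu$ and with the effective resistance metric $d$ associated to a Dirichlet form $\mathcal{E}$. Assume that there exist positive constants $b, C_1, C_2$ such that for all $x\in K$ and all $r>0$ $$C_1 r^b\leq \mu(B_r(x))\leq C_2 r^b .$$ Let $\gamma=b+1$. Then there exists a constant $C>0$ such that for all $u\in \mathcal{D}om(\mathcal{E})$ with $\|u\|_{2}=1$ one has $$Var_\gamma(u)\,\mathcal{E}(u,u)\geq C.$$
   Context: $(K,d)$ is a metric space equipped with a Borel measure $\mu$, and $\mathcal{E}$ is a Dirichlet form with domain $\mathcal{D}om(\mathcal{E})\subset L^2(K,\mu)$. By convention, $\|u\|_2=\infty$ if $u$ is not square integrable and $\mathcal{E}(u,u)=\infty$ if $u\notin\mathcal{D}om(\mathcal{E})$. It is assumed that $d$ is the effective resistance metric associated to $\mathcal{E}$, i.e. that $$d(x,y)=\sup \mathcal{E}(u,u)^{-1},$$ where the supremum is over all continuous functions $u$ with $u(x)=1$, $u(y)=0$ (in particular this quantity is assumed to be finite); in this setting $\mathcal{E}$ is also called a resistance form (in the sense of Kigami, "Harmonic analysis for resistance forms"). $B_r(x)$ denotes the ball with center $x$ and radius $r$ in the metric $d$. The norm $\|\cdot\|_2$ is the norm of $L^2(K,\mu)$. The spatial variance is $$Var_\gamma(u)=\iint_{K\times K}d(x,y)^\gamma |u(x)|^2|u(y)|^2\,d\mu(x)\,d\mu(y).$$ The constant $C$ does not depend on $u$. *)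

theory Defs
  imports "HOL-Analysis.Analysis"
begin

definition L2 :: "'a measure \<Rightarrow> ('a \<Rightarrow> real) set" where
  "L2 M = {f. f \<in> borel_measurable M \<and> integrable M (\<lambda>x. (f x)\<^sup>2)}"

text \<open>Meaningful only for functions in \<open>L2 M\<close>.\<close>

definition l2_norm :: "'a measure \<Rightarrow> ('a \<Rightarrow> real) \<Rightarrow> real" where
  "l2_norm M f = sqrt (\<integral>x. (f x)\<^sup>2 \<partial>M)"

text \<open>A Dirichlet form is a densely defined, nonnegative, symmetric, closed, Markovian bilinear
  form on \<open>L\<^sup>2\<close>. Elements of \<open>L\<^sup>2\<close> are represented by functions rather than by equivalence classes:
  the domain \<open>D\<close> is saturated under equality almost everywhere and \<open>E\<close> respects it. The values of
  \<open>E\<close> outside \<open>D\<close> are irrelevant.\<close>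

locale dirichlet_form =
  fixes M :: "'a measure"
    and E :: "('a \<Rightarrow> real) \<Rightarrow> ('a \<Rightarrow> real) \<Rightarrow> real"
    and D :: "('a \<Rightarrow> real) set"
  assumes domain_subset: "D \<subseteq> L2 M"
    and domain_AE: "\<lbrakk>u \<in> D; v \<in> L2 M; AE x in M. u x = v x\<rbrakk> \<Longrightarrow> v \<in> D"
    and form_AE: "\<lbrakk>u \<in> D; v \<in> D; w \<in> D; AE x in M. u x = v x\<rbrakk> \<Longrightarrow> E u w = E v w"
    and domain_zero: "(\<lambda>x. 0) \<in> D"
    and domain_add: "\<lbrakk>u \<in> D; v \<in> D\<rbrakk> \<Longrightarrow> (\<lambda>x. u x + v x) \<in> D"
    and domain_scale: "u \<in> D \<Longrightarrow> (\<lambda>x. c * u x) \<in> D"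
    and domain_dense: "\<lbrakk>f \<in> L2 M; 0 < e\<rbrakk> \<Longrightarrow> \<exists>u\<in>D. l2_norm M (\<lambda>x. f x - u x) < e"
    and form_add: "\<lbrakk>u \<in> D; v \<in> D; w \<in> D\<rbrakk> \<Longrightarrow> E (\<lambda>x. u x + v x) w = E u w + E v w"
    and form_scale: "\<lbrakk>u \<in> D; w \<in> D\<rbrakk> \<Longrightarrow> E (\<lambda>x. c * u x) w = c * E u w"
    and form_sym: "\<lbrakk>u \<in> D; v \<in> D\<rbrakk> \<Longrightarrow> E u v = E v u"
    and form_nonneg: "u \<in> D \<Longrightarrow> 0 \<le> E u u"
    and form_closed:
      "\<lbrakk>\<And>n::nat. s n \<in> D;
        \<And>e. 0 < e \<Longrightarrow> \<exists>N. \<forall>m\<ge>N. \<forall>n\<ge>N.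
          E (\<lambda>x. s m x - s n x) (\<lambda>x. s m x - s n x) + (l2_norm M (\<lambda>x. s m x - s n x))\<^sup>2 < e\<rbrakk>
       \<Longrightarrow> \<exists>u\<in>D. (\<lambda>n. E (\<lambda>x. s n x - u x) (\<lambda>x. s n x - u x)
              + (l2_norm M (\<lambda>x. s n x - u x))\<^sup>2) \<longlonglongrightarrow> 0"
    and form_markov:
      "u \<in> D \<Longrightarrow> (\<lambda>x. min (max (u x) 0) 1) \<in> D \<and>
         E (\<lambda>x. min (max (u x) 0) 1) (\<lambda>x. min (max (u x) 0) 1) \<le> E u u"

definition energy ::
    "(('a \<Rightarrow> real) \<Rightarrow> ('a \<Rightarrow> real) \<Rightarrow> real) \<Rightarrow> ('a \<Rightarrow> real) set \<Rightarrow> ('a \<Rightarrow> real) \<Rightarrow> ennreal" where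
  "energy E D u = (if u \<in> D then ennreal (E u u) else \<infinity>)"

text \<open>In \<open>ennreal\<close> we have \<open>inverse \<infinity> = 0\<close>, \<open>inverse 0 = \<infinity>\<close> and \<open>Sup {} = 0\<close>. Hence functions
  outside the domain do not contribute, the value is infinite as soon as some admissible
  function has zero energy, and the value is zero for \<open>x = y\<close>.\<close>

definition effective_resistance ::
    "(('a::topological_space \<Rightarrow> real) \<Rightarrow> ('a \<Rightarrow> real) \<Rightarrow> real) \<Rightarrow> ('a \<Rightarrow> real) set
      \<Rightarrow> 'a \<Rightarrow> 'a \<Rightarrow> ennreal" where
  "effective_resistance E D x y =
    (SUP u \<in> {u. continuous_on UNIV u \<and> u x = 1 \<and> u y = 0}. inverse (energy E D u))"

text \<open>On an infinite measure space the domain \<open>D\<close> of a Dirichlet form cannot contain the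
  constants, so it is not literally the domain of a resistance form in Kigami's sense; it is the
  \<open>L\<^sup>2\<close> part of one. What is recorded here is what this entails for \<open>D\<close> in addition to the formula
  for the metric: its elements are continuous functions, up to null sets. The formula alone does
  not imply this, because it only tests continuous functions: for the form of \<open>H\<^sup>1\<close> of the real
  line with the integers removed it still yields the Euclidean distance.\<close>

definition has_continuous_versions ::
    "'a::topological_space measure \<Rightarrow> ('a \<Rightarrow> real) set \<Rightarrow> bool" where
  "has_continuous_versions M D \<longleftrightarrow>
    (\<forall>u\<in>D. \<exists>v. continuous_on UNIV v \<and> (AE x in M. u x = v x))"

definition spatial_variance ::
    "'a::metric_space measure \<Rightarrow> real \<Rightarrow> ('a \<Rightarrow> real) \<Rightarrow> ennreal" where
  "spatial_variance M \<gamma> u =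
    (\<integral>\<^sup>+ (x, y). ennreal (dist x y powr \<gamma> * \<bar>u x\<bar>\<^sup>2 * \<bar>u y\<bar>\<^sup>2) \<partial>(M \<Otimes>\<^sub>M M))"

end

(* Truncation turns the resistance formula into |v x - v y|^2 <= 4 d(x,y) E(v,v) for continuous v
   in the domain. If Var(u) < V, then some ball of radius R with R^(b+1) = 2V carries half of the
   mass of u^2. The upper volume bound gives a point of this ball at which u^2 is at least of
   order R^(-b), and the lower volume bound gives a point of a ball of proportional radius at which
   |u| is at most half as large. Comparing the two points yields V E(u,u) >= C. *)

theory Submission
  imports Defs
begin

section \<open>Truncations in a Dirichlet form\<close>

lemma (in dirichlet_form) domain_diff:
  assumes "u \<in> D" "v \<in> D"
  shows "(\<lambda>x. u x - v x) \<in> D"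
  using domain_add[OF assms(1) domain_scale[OF assms(2), of "-1"]] by simp

lemma (in dirichlet_form) form_scale_square:
  assumes "u \<in> D"
  shows "E (\<lambda>x. c * u x) (\<lambda>x. c * u x) = c\<^sup>2 * E u u"
  using assms form_sym[OF assms domain_scale[OF assms], of c]
  by (simp add: form_scale domain_scale power2_eq_square)

lemma (in dirichlet_form) form_add_square:
  assumes "u \<in> D" "v \<in> D"
  shows "E (\<lambda>x. u x + v x) (\<lambda>x. u x + v x) = E u u + 2 * E u v + E v v"
  using assms by (simp add: form_add form_sym[of _ "\<lambda>x. u x + v x"] domain_add form_sym[of v u])

text \<open>Rescaling by \<open>1/c\<close> reduces this to the Markov property at height 1; the
  factors \<open>c\<^sup>2\<close> and \<open>(1/c)\<^sup>2\<close> produced by the quadratic form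
  cancel.\<close>

lemma (in dirichlet_form) clamp_domain_energy:
  assumes "u \<in> D" "0 < c"
  shows "(\<lambda>x. min (max (u x) 0) c) \<in> D"
    and "E (\<lambda>x. min (max (u x) 0) c) (\<lambda>x. min (max (u x) 0) c) \<le> E u u"
proof -
  define s where "s = (\<lambda>x. (1/c) * u x)"
  have sD: "s \<in> D" unfolding s_def by (rule domain_scale[OF assms(1)])
  define w where "w = (\<lambda>x. min (max (s x) 0) 1)"
  have w: "w \<in> D" "E w w \<le> E s s" using form_markov[OF sD] unfolding w_def by auto
  have eq: "(\<lambda>x. min (max (u x) 0) c) = (\<lambda>x. c * w x)"
    using assms(2) by (auto simp: fun_eq_iff w_def s_def min_def max_def field_simps)
  show "(\<lambda>x. min (max (u x) 0) c) \<in> D" unfolding eq by (rule domain_scale[OF w(1)])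
  have "E (\<lambda>x. c * w x) (\<lambda>x. c * w x) = c\<^sup>2 * E w w" by (rule form_scale_square[OF w(1)])
  also have "\<dots> \<le> c\<^sup>2 * E s s" using w(2) by (simp add: mult_left_mono)
  also have "E s s = (1/c)\<^sup>2 * E u u" unfolding s_def by (rule form_scale_square[OF assms(1)])
  also have "c\<^sup>2 * ((1/c)\<^sup>2 * E u u) = E u u" using assms(2) by (simp add: power2_eq_square)
  finally show "E (\<lambda>x. min (max (u x) 0) c) (\<lambda>x. min (max (u x) 0) c) \<le> E u u"
    unfolding eq .
qed

text \<open>Stands in for subtracting the constant \<open>a\<close>, which may lie outside
  \<open>D\<close>. If \<open>p\<close> is the part of \<open>w\<close> below \<open>a\<close> and
  \<open>q\<close> the excess, then \<open>E w w\<close> equals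
  \<open>E p p + 2 * E p q + E q q\<close>, so it suffices that the cross term is
  nonnegative.\<close>

lemma (in dirichlet_form) excess_domain_energy:
  assumes "w \<in> D" "\<And>x. 0 \<le> w x" "0 \<le> a"
  shows "(\<lambda>x. w x - min (w x) a) \<in> D"
    and "E (\<lambda>x. w x - min (w x) a) (\<lambda>x. w x - min (w x) a) \<le> E w w"
proof -
  have "(\<lambda>x. w x - min (w x) a) \<in> D \<and>
    E (\<lambda>x. w x - min (w x) a) (\<lambda>x. w x - min (w x) a) \<le> E w w"
  \<comment> \<open>Clamping is available only at positive height; at height 0 the excess is
    \<open>w\<close> itself.\<close>
  proof (cases "a = 0")
    case True
    then have "(\<lambda>x. w x - min (w x) a) = w" using assms(2) by (auto simp: fun_eq_iff min_def)
        (metis antisym)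
    then show ?thesis using assms(1) by simp
  next
    case False
    with assms(3) have a: "0 < a" by simp
    define p where "p = (\<lambda>x. min (w x) a)"
    define q where "q = (\<lambda>x. w x - min (w x) a)"
    have "p = (\<lambda>x. min (max (w x) 0) a)" using assms(2) by (simp add: p_def max_absorb1)
    then have pD: "p \<in> D" using clamp_domain_energy(1)[OF assms(1) a] by simp
    have qD: "q \<in> D" using domain_diff[OF assms(1) pD] unfolding q_def p_def .
    \<comment> \<open>Adding a positive multiple of \<open>q\<close> to \<open>p\<close> is undone by truncation at height \<open>a\<close>.\<close>
    have pq: "0 \<le> 2 * E p q + t * E q q" if t: "0 < t" for t
    proof -
      have tq: "(\<lambda>x. t * q x) \<in> D" by (rule domain_scale[OF qD])
      have "min (max (p x + t * q x) 0) a = p x" for x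
      proof (cases "w x \<le> a")
        case True
        then show ?thesis using assms(2)[of x] by (simp add: p_def q_def)
      next
        case False
        then have "0 \<le> t * (w x - a)" using t by simp
        then show ?thesis using False a by (simp add: p_def q_def min_def max_def)
      qed
      then have "E p p \<le> E (\<lambda>x. p x + t * q x) (\<lambda>x. p x + t * q x)"
        using clamp_domain_energy(2)[OF domain_add[OF pD tq] a] by simp
      also have "\<dots> = E p p + 2 * E p (\<lambda>x. t * q x) + t\<^sup>2 * E q q"
        by (simp add: form_add_square[OF pD tq] form_scale_square[OF qD])
      also have "E p (\<lambda>x. t * q x) = t * E p q"
        using form_sym[OF pD tq] form_scale[OF qD pD] form_sym[OF pD qD] by simp
      finally have "0 \<le> t * (2 * E p q + t * E q q)" by (simp add: algebra_simps power2_eq_square)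
      then show ?thesis using t by (simp add: zero_le_mult_iff)
    qed
    \<comment> \<open>The quadratic term disappears as \<open>t\<close> tends to 0 from the right,
      which leaves the sign of the cross term.\<close>
    have "((\<lambda>t. 2 * E p q + t * E q q) \<longlongrightarrow> 2 * E p q + 0 * E q q) (at_right 0)"
      by (intro tendsto_intros)
    then have "0 \<le> 2 * E p q + 0 * E q q"
      by (rule tendsto_lowerbound) (auto simp: eventually_at_right_less pq intro!: eventually_at_rightI[of 0 1])
    moreover have "w = (\<lambda>x. p x + q x)" by (simp add: p_def q_def)
    then have "E w w = E p p + 2 * E p q + E q q" using form_add_square[OF pD qD] by simp
    ultimately have "E q q \<le> E w w" using form_nonneg[OF pD] by simp
    with qD show ?thesis unfolding q_def by simp
  qed
  then show "(\<lambda>x. w x - min (w x) a) \<in> D"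
    and "E (\<lambda>x. w x - min (w x) a) (\<lambda>x. w x - min (w x) a) \<le> E w w" by auto
qed

section \<open>Pointwise estimates from the resistance metric\<close>

locale resistance_metric_form = dirichlet_form M E D
  for M :: "'a::metric_space measure" and E D +
  assumes dist_eq: "\<And>x y. ennreal (dist x y) = effective_resistance E D x y"
begin

text \<open>Dividing \<open>w\<close> by \<open>w x\<close> makes it admissible in the supremum
  defining the resistance, and its energy is then \<open>E w w / (w x)\<^sup>2\<close>.\<close>

lemma square_le_dist_energy:
  assumes "w \<in> D" "continuous_on UNIV w" "w y = 0"
  shows "(w x)\<^sup>2 \<le> dist x y * E w w"
proof (cases "w x = 0")
  case True
  then show ?thesis using form_nonneg[OF assms(1)] by simp
next
  case False
  define s where "s = (\<lambda>z. (1 / w x) * w z)"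
  have sD: "s \<in> D" unfolding s_def by (rule domain_scale[OF assms(1)])
  have "continuous_on UNIV s" "s x = 1" "s y = 0"
    using assms False by (auto simp: s_def intro!: continuous_intros)
  then have "inverse (energy E D s) \<le> effective_resistance E D x y"
    unfolding effective_resistance_def by (intro SUP_upper) simp
  then have le: "inverse (ennreal (E s s)) \<le> ennreal (dist x y)"
    using sD by (simp add: energy_def dist_eq)
  \<comment> \<open>Zero energy would make the left side of \<open>le\<close> infinite, but
    distances are finite.\<close>
  have pos: "0 < E s s"
  proof (rule ccontr)
    assume "\<not> 0 < E s s"
    then have "E s s = 0" using form_nonneg[OF sD] by simp
    with le show False by (simp add: top_unique)
  qed
  then have "inverse (E s s) \<le> dist x y" using le by (simp add: inverse_ennreal)
  then have "1 \<le> dist x y * E s s" using pos by (simp add: field_simps)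
  also have "E s s = (1 / w x)\<^sup>2 * E w w" unfolding s_def by (rule form_scale_square[OF assms(1)])
  finally show ?thesis using False by (simp add: field_simps)
qed

text \<open>Clamp \<open>u\<close> between 0 and \<open>u x\<close>, then cut off the part below
  \<open>u y\<close>. Neither operation raises the energy, and the result vanishes at
  \<open>y\<close> and equals \<open>u x - u y\<close> at \<open>x\<close>.\<close>

lemma diff_square_le_nonneg:
  assumes "u \<in> D" "continuous_on UNIV u" "0 \<le> u y" "u y \<le> u x"
  shows "(u x - u y)\<^sup>2 \<le> dist x y * E u u"
proof (cases "u x = 0")
  case True
  then show ?thesis using assms form_nonneg[OF assms(1)] by simp
next
  case False
  then have c: "0 < u x" using assms by simp
  define w where "w = (\<lambda>z. min (max (u z) 0) (u x))"
  have w: "w \<in> D" "E w w \<le> E u u"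
    using clamp_domain_energy[OF assms(1) c] unfolding w_def by auto
  have w0: "0 \<le> w z" for z using c by (simp add: w_def)
  define q where "q = (\<lambda>z. w z - min (w z) (u y))"
  have q: "q \<in> D" "E q q \<le> E w w"
    using excess_domain_energy[OF w(1) w0 assms(3)] unfolding q_def by auto
  have "continuous_on UNIV q" using assms(2) unfolding q_def w_def by (intro continuous_intros)
  moreover have "q y = 0" using assms by (simp add: q_def w_def)
  ultimately have "(q x)\<^sup>2 \<le> dist x y * E q q" by (rule square_le_dist_energy[OF q(1)])
  also have "\<dots> \<le> dist x y * E u u" using q(2) w(2) by (intro mult_left_mono) auto
  finally show ?thesis using assms by (simp add: q_def w_def)
qed

text \<open>The constants need not belong to \<open>D\<close>, so \<open>u - u y\<close> is not admissible in the formula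
  for the metric. Truncation replaces it; the factor 4 comes from treating the positive and
  negative parts of \<open>u\<close> separately.\<close>

lemma diff_square_le:
  assumes "u \<in> D" "continuous_on UNIV u"
  shows "(u x - u y)\<^sup>2 \<le> 4 * dist x y * E u u"
proof -
  have neg: "(\<lambda>z. - u z) \<in> D" "E (\<lambda>z. - u z) (\<lambda>z. - u z) = E u u"
    using domain_scale[OF assms(1), of "-1"] form_scale_square[OF assms(1), of "-1"] by auto
  have cneg: "continuous_on UNIV (\<lambda>z. - u z)" using assms(2) by (intro continuous_intros)
  have nn: "0 \<le> dist x y * E u u" using form_nonneg[OF assms(1)] by simp
  have pos_part: "(u' x')\<^sup>2 \<le> dist x' y' * E u' u'"
    if "u' \<in> D" "continuous_on UNIV u'" "u' y' \<le> 0" "0 < u' x'" for u' x' y'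
  proof -
    define w where "w = (\<lambda>z. min (max (u' z) 0) (u' x'))"
    have w: "w \<in> D" "E w w \<le> E u' u'"
      using clamp_domain_energy[OF that(1,4)] unfolding w_def by auto
    have "continuous_on UNIV w" using that(2) unfolding w_def by (intro continuous_intros)
    then have "(w x')\<^sup>2 \<le> dist x' y' * E w w"
      using that by (intro square_le_dist_energy[OF w(1)]) (auto simp: w_def)
    also have "\<dots> \<le> dist x' y' * E u' u'" using w(2) by (intro mult_left_mono) auto
    finally show ?thesis using that by (simp add: w_def)
  qed
  \<comment> \<open>Apply \<open>pos_part\<close> to \<open>u\<close>, and to \<open>-u\<close> with
    the points exchanged; the square of the difference is at most twice the sum of the
    squares.\<close>
  have opp: "(u x' - u y')\<^sup>2 \<le> 4 * (dist x' y' * E u u)" if "u y' < 0" "0 < u x'" for x' y'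
  proof -
    have "(u x')\<^sup>2 \<le> dist x' y' * E u u" using pos_part[OF assms] that by simp
    moreover have "(u y')\<^sup>2 \<le> dist x' y' * E u u"
      using pos_part[OF neg(1) cneg, of x' y'] that neg(2) by (simp add: dist_commute)
    moreover have "(u x' - u y')\<^sup>2 \<le> 2 * (u x')\<^sup>2 + 2 * (u y')\<^sup>2"
      using zero_le_power2[of "u x' + u y'"] by (simp add: power2_eq_square algebra_simps)
    ultimately show ?thesis by linarith
  qed
  consider "0 \<le> u y" "u y \<le> u x" | "0 \<le> u x" "u x \<le> u y" | "u y \<le> 0" "u x \<le> u y"
    | "u x \<le> 0" "u y \<le> u x" | "u y < 0" "0 < u x" | "u x < 0" "0 < u y"
    by linarith
  then show ?thesis
  proof cases
    case 1
    then show ?thesis using diff_square_le_nonneg[OF assms, of y x] nn by simp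
  next
    case 2
    then show ?thesis using diff_square_le_nonneg[OF assms, of x y] nn
      by (simp add: dist_commute power2_commute)
  next
    case 3
    then show ?thesis using diff_square_le_nonneg[OF neg(1) cneg, of y x] nn neg(2)
      by (simp add: power2_commute)
  next
    case 4
    then show ?thesis using diff_square_le_nonneg[OF neg(1) cneg, of x y] nn neg(2)
      by (simp add: dist_commute power2_commute)
  next
    case 5
    then show ?thesis using opp[of y x] by simp
  next
    case 6
    then show ?thesis using opp[of x y] by (simp add: dist_commute power2_commute)
  qed
qed

end

section \<open>Ahlfors regular measures: separability and concentration of mass\<close>

locale ahlfors_regular =
  fixes M :: "'a::metric_space measure" and b C\<^sub>1 C\<^sub>2 :: real
  assumes sets_eq: "sets M = sets borel"
    and b_pos: "0 < b" and C1_pos: "0 < C\<^sub>1" and C2_pos: "0 < C\<^sub>2"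
    and ball_lower: "\<And>x r. 0 < r \<Longrightarrow> ennreal (C\<^sub>1 * r powr b) \<le> emeasure M (ball x r)"
    and ball_upper: "\<And>x r. 0 < r \<Longrightarrow> emeasure M (ball x r) \<le> ennreal (C\<^sub>2 * r powr b)"
begin

lemma space_eq [simp]: "space M = UNIV"
  using sets_eq_imp_space_eq[OF sets_eq] by simp

lemma ball_in_sets [measurable, simp]: "ball x r \<in> sets M"
  by (simp add: sets_eq)

lemma continuous_measurable:
  fixes f :: "'a \<Rightarrow> 'b::topological_space"
  assumes "continuous_on UNIV f"
  shows "f \<in> borel_measurable M"
  using borel_measurable_continuous_onI[OF assms] measurable_cong_sets[OF sets_eq refl] by blast

text \<open>A packing argument: without a finite net there are \<open>e\<close>-separated subsets of
  \<open>ball x r\<close> of every size. Balls of radius \<open>e/2\<close> around their points are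
  disjoint, have volume bounded below, and all lie in \<open>ball x (r + e)\<close>, which has
  finite volume.\<close>

lemma finite_net:
  fixes x :: 'a
  assumes e: "0 < e" and r: "0 < r"
  shows "\<exists>F. finite F \<and> ball x r \<subseteq> (\<Union>p\<in>F. ball p e)"
proof (rule ccontr)
  assume no: "\<nexists>F. finite F \<and> ball x r \<subseteq> (\<Union>p\<in>F. ball p e)"
  have sep: "\<exists>F \<subseteq> ball x r. finite F \<and> card F = k \<and> pairwise (\<lambda>p q. e \<le> dist p q) F" for k
  proof (induction k)
    case 0
    show ?case by (intro exI[of _ "{}"]) auto
  next
    case (Suc k)
    then obtain F where F: "F \<subseteq> ball x r" "finite F" "card F = k"
      "pairwise (\<lambda>p q. e \<le> dist p q) F" by blast
    then obtain z where z: "z \<in> ball x r" "z \<notin> (\<Union>p\<in>F. ball p e)" using no by blast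
    then have far: "e \<le> dist p z" if "p \<in> F" for p using that by (auto simp: not_less)
    then have "z \<notin> F" using e by force
    moreover have "pairwise (\<lambda>p q. e \<le> dist p q) (insert z F)"
      using F(4) far by (auto simp: pairwise_insert dist_commute)
    ultimately show ?case using F z by (intro exI[of _ "insert z F"]) auto
  qed
  have bound: "real k * (C\<^sub>1 * (e/2) powr b) \<le> C\<^sub>2 * (r + e) powr b" for k
  proof -
    obtain F where F: "F \<subseteq> ball x r" "finite F" "card F = k"
      "pairwise (\<lambda>p q. e \<le> dist p q) F" using sep by blast
    have disj: "disjoint_family_on (\<lambda>p. ball p (e/2)) F"
    proof (unfold disjoint_family_on_def, intro ballI impI)
      fix p q assume pq: "p \<in> F" "q \<in> F" "p \<noteq> q"
      then have "e \<le> dist p q" using F(4) by (auto simp: pairwise_def)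
      then show "ball p (e/2) \<inter> ball q (e/2) = {}" by (intro disjoint_ballI) simp
    qed
    have "ennreal (real k * (C\<^sub>1 * (e/2) powr b)) = (\<Sum>p\<in>F. ennreal (C\<^sub>1 * (e/2) powr b))"
      using F(3) C1_pos by (simp add: ennreal_mult ennreal_of_nat_eq_real_of_nat)
    also have "\<dots> \<le> (\<Sum>p\<in>F. emeasure M (ball p (e/2)))"
      using e by (intro sum_mono ball_lower) simp
    also have "\<dots> = emeasure M (\<Union>p\<in>F. ball p (e/2))"
      using disj F(2) by (intro sum_emeasure) auto
    also have "\<dots> \<le> emeasure M (ball x (r + e))"
    proof (rule emeasure_mono)
      show "(\<Union>p\<in>F. ball p (e/2)) \<subseteq> ball x (r + e)"
      proof safe
        fix p y assume "p \<in> F" "y \<in> ball p (e/2)"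
        then have "dist x p < r" "dist p y < e/2" using F(1) by auto
        then show "y \<in> ball x (r + e)" using e dist_triangle[of x y p] by simp
      qed
    qed simp
    also have "\<dots> \<le> ennreal (C\<^sub>2 * (r + e) powr b)" using e r by (intro ball_upper) simp
    finally show ?thesis using C2_pos by (simp add: ennreal_le_iff)
  qed
  have "0 < C\<^sub>1 * (e/2) powr b" using e C1_pos by simp
  then obtain k where "C\<^sub>2 * (r + e) powr b < real k * (C\<^sub>1 * (e/2) powr b)"
    using reals_Archimedean3 by blast
  with bound[of k] show False by simp
qed

text \<open>Collect finite nets of mesh \<open>1 / Suc m\<close> for the balls of radius
  \<open>Suc n\<close> around one base point, for which \<open>undefined\<close> serves.\<close>

lemma countable_dense:
  obtains Q :: "'a set" where "countable Q" "\<And>x e. 0 < e \<Longrightarrow> \<exists>q\<in>Q. dist x q < e"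
proof -
  have "\<exists>F. finite F \<and> ball (undefined::'a) (real (Suc n)) \<subseteq> (\<Union>p\<in>F. ball p (1 / real (Suc m)))"
    for n m
    by (rule finite_net) auto
  then obtain F where F: "\<And>n m. finite (F n m)"
    "\<And>n m. ball (undefined::'a) (real (Suc n)) \<subseteq> (\<Union>p\<in>F n m. ball p (1 / real (Suc m)))"
    by metis
  show thesis
  proof
    show "countable (\<Union>n m. F n m)" using F(1) by (intro countable_UN) (auto simp: countable_finite)
    fix x :: 'a and e :: real assume "0 < e"
    then obtain m where m: "1 / real (Suc m) < e" using nat_approx_posE by metis
    obtain n where "dist undefined x < real n" using reals_Archimedean2 by blast
    then have "x \<in> ball undefined (real (Suc n))" by simp
    then obtain p where "p \<in> F n m" "dist p x < 1 / real (Suc m)" using F(2)[of n m] by auto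
    with m show "\<exists>q\<in>(\<Union>n m. F n m). dist x q < e" by (force simp: dist_commute)
  qed
qed

lemma sigma_finite: "sigma_finite_measure M"
proof
  show "\<exists>A. countable A \<and> A \<subseteq> sets M \<and> \<Union>A = space M \<and> (\<forall>a\<in>A. emeasure M a \<noteq> \<infinity>)"
  proof (intro exI[of _ "range (\<lambda>n. ball undefined (real (Suc n)))"] conjI ballI)
    have "x \<in> (\<Union>n. ball (undefined::'a) (real (Suc n)))" for x
    proof -
      obtain n where "dist undefined x < real n" using reals_Archimedean2 by blast
      then show ?thesis by (intro UN_I[of n]) auto
    qed
    then show "\<Union>(range (\<lambda>n. ball undefined (real (Suc n)))) = space M" by auto
    fix a assume "a \<in> range (\<lambda>n. ball (undefined::'a) (real (Suc n)))"
    then obtain n where "a = ball undefined (real (Suc n))" by blast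
    then show "emeasure M a \<noteq> \<infinity>"
      using ball_upper[of "real (Suc n)" undefined] by (auto simp: top_unique)
  qed auto
qed

text \<open>On a nonseparable space the distance need not be measurable with respect to the product
  \<open>\<sigma>\<close>-algebra.\<close>

lemma dist_measurable: "(\<lambda>z. dist (fst z) (snd z)) \<in> borel_measurable (M \<Otimes>\<^sub>M M)"
proof (rule borel_measurableI_less)
  fix a :: real
  obtain Q :: "'a set" where Q: "countable Q" "\<And>x e. 0 < e \<Longrightarrow> \<exists>q\<in>Q. dist x q < e"
    using countable_dense by blast
  have [measurable]: "(\<lambda>x. dist x q) \<in> borel_measurable M" for q
    by (intro continuous_measurable continuous_intros)
  \<comment> \<open>Routing the distance through a point of \<open>Q\<close> close to the first
    coordinate turns the sublevel set into a countable union of sets described by functions of one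
    variable each.\<close>
  have eq: "{z \<in> space (M \<Otimes>\<^sub>M M). dist (fst z) (snd z) < a} =
      (\<Union>q\<in>Q. {z \<in> space (M \<Otimes>\<^sub>M M). dist (fst z) q + dist (snd z) q < a})" (is "?A = ?B")
  proof
    show "?A \<subseteq> ?B"
    proof
      fix z assume z: "z \<in> ?A"
      then have "0 < (a - dist (fst z) (snd z)) / 2" by simp
      then obtain q where q: "q \<in> Q" "dist (fst z) q < (a - dist (fst z) (snd z)) / 2"
        using Q(2) by blast
      have "dist (snd z) q \<le> dist (fst z) (snd z) + dist (fst z) q"
        using dist_triangle[of "snd z" q "fst z"] by (simp add: dist_commute)
      with q have "dist (fst z) q + dist (snd z) q < a" by (simp add: field_simps)
      with q(1) z show "z \<in> ?B" by auto
    qed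
    show "?B \<subseteq> ?A"
    proof
      fix z assume "z \<in> ?B"
      then obtain q where q: "z \<in> space (M \<Otimes>\<^sub>M M)" "dist (fst z) q + dist (snd z) q < a" by auto
      then have "dist (fst z) (snd z) < a"
        using dist_triangle[of "fst z" "snd z" q] by (simp add: dist_commute)
      with q(1) show "z \<in> ?A" by auto
    qed
  qed
  show "{z \<in> space (M \<Otimes>\<^sub>M M). dist (fst z) (snd z) < a} \<in> sets (M \<Otimes>\<^sub>M M)"
    unfolding eq using Q(1) by (intro sets.countable_UN') auto
qed

text \<open>Regard \<open>u\<^sup>2\<close> as a probability density. The variance is then the mean
  of \<open>G x\<close>, the moment of order \<open>g\<close> about \<open>x\<close>, so some centre
  has moment below \<open>V\<close>. By Markov's inequality at most half of the mass lies at
  distance \<open>R\<close> or more from it.\<close>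

lemma concentration:
  assumes u [measurable]: "u \<in> borel_measurable M"
    and one: "(\<integral>\<^sup>+x. ennreal ((u x)\<^sup>2) \<partial>M) = 1"
    and V: "0 < V" "spatial_variance M g u < ennreal V"
    and R: "0 < R" "R powr g = 2 * V" and g: "0 < g"
  shows "\<exists>x. ennreal (1/2) \<le> (\<integral>\<^sup>+y. ennreal ((u y)\<^sup>2) * indicator (ball x R) y \<partial>M)"
proof -
  interpret sigma_finite_measure M by (rule sigma_finite)
  note dist_measurable [measurable]
  have slice [measurable]: "(\<lambda>y. dist x y) \<in> borel_measurable M" for x
    by (intro continuous_measurable continuous_intros)
  define G where "G x = (\<integral>\<^sup>+y. ennreal (dist x y powr g * (u y)\<^sup>2) \<partial>M)" for x
  define f where "f = (\<lambda>z. ennreal (dist (fst z) (snd z) powr g * \<bar>u (fst z)\<bar>\<^sup>2 * \<bar>u (snd z)\<bar>\<^sup>2))"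
  have f [measurable]: "f \<in> borel_measurable (M \<Otimes>\<^sub>M M)" unfolding f_def by measurable
  have "spatial_variance M g u = integral\<^sup>N (M \<Otimes>\<^sub>M M) f"
    unfolding spatial_variance_def f_def by (simp add: case_prod_unfold)
  also have "\<dots> = (\<integral>\<^sup>+x. \<integral>\<^sup>+y. f (x, y) \<partial>M \<partial>M)"
    by (rule nn_integral_fst[symmetric]) (rule f)
  also have "\<dots> = (\<integral>\<^sup>+x. ennreal ((u x)\<^sup>2) * G x \<partial>M)"
  proof (rule nn_integral_cong)
    fix x
    have "f (x, y) = ennreal ((u x)\<^sup>2) * ennreal (dist x y powr g * (u y)\<^sup>2)" for y
      unfolding f_def by (simp flip: ennreal_mult add: ac_simps)
    then show "(\<integral>\<^sup>+y. f (x, y) \<partial>M) = ennreal ((u x)\<^sup>2) * G x"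
      unfolding G_def by (simp add: nn_integral_cmult)
  qed
  finally have sv: "spatial_variance M g u = (\<integral>\<^sup>+x. ennreal ((u x)\<^sup>2) * G x \<partial>M)" .
  obtain x where x: "G x < ennreal V"
  proof (rule ccontr)
    assume "\<not> thesis"
    with that have ge: "ennreal V \<le> G x" for x by (meson not_less)
    have "ennreal V = (\<integral>\<^sup>+x. ennreal ((u x)\<^sup>2) * ennreal V \<partial>M)"
      by (simp add: nn_integral_multc one)
    also have "\<dots> \<le> spatial_variance M g u"
      unfolding sv by (intro nn_integral_mono mult_left_mono ge) simp
    finally show False using V(2) by simp
  qed
  let ?B = "\<integral>\<^sup>+y. ennreal ((u y)\<^sup>2) * indicator (ball x R) y \<partial>M"
  \<comment> \<open>Pointwise form of Markov's inequality: outside the ball,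
    \<open>dist x y powr g\<close> is at least \<open>2 * V\<close>.\<close>
  have pw: "ennreal ((u y)\<^sup>2) \<le> ennreal ((u y)\<^sup>2) * indicator (ball x R) y +
      ennreal (1 / (2*V)) * ennreal (dist x y powr g * (u y)\<^sup>2)" for y
  proof (cases "dist x y < R")
    case True
    then show ?thesis by simp
  next
    case False
    then have "2 * V \<le> dist x y powr g" using R g by (auto simp flip: R(2) intro!: powr_mono2)
    then have "1 \<le> 1 / (2*V) * dist x y powr g" using V(1) by (simp add: field_simps)
    then have "1 * (u y)\<^sup>2 \<le> 1 / (2*V) * dist x y powr g * (u y)\<^sup>2" by (intro mult_right_mono) auto
    then show ?thesis using False V(1) by (simp flip: ennreal_mult add: ennreal_leI)
  qed
  have "1 \<le> (\<integral>\<^sup>+y. (ennreal ((u y)\<^sup>2) * indicator (ball x R) y +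
      ennreal (1 / (2*V)) * ennreal (dist x y powr g * (u y)\<^sup>2)) \<partial>M)"
    unfolding one[symmetric] by (intro nn_integral_mono pw)
  also have "\<dots> = ?B + ennreal (1 / (2*V)) * G x"
    unfolding G_def by (simp add: nn_integral_add nn_integral_cmult)
  also have "\<dots> \<le> ?B + ennreal (1 / (2*V)) * ennreal V"
    using x by (intro add_left_mono mult_left_mono) auto
  also have "ennreal (1 / (2*V)) * ennreal V = ennreal (1/2)"
    using V(1) by (simp flip: ennreal_mult)
  finally have le: "1 \<le> ?B + ennreal (1/2)" .
  \<comment> \<open>The summand 1/2 is cancelled in the reals; an infinite mass satisfies the bound
    trivially.\<close>
  have "ennreal (1/2) \<le> ?B"
  proof (cases ?B)
    case (real r)
    then have "ennreal 1 \<le> ennreal (r + 1/2)" using le by (simp add: ennreal_plus)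
    then have "1/2 \<le> r" using real(1) by (subst (asm) ennreal_le_iff) auto
    then show ?thesis unfolding real(2) by (rule ennreal_leI)
  qed simp
  then show ?thesis by blast
qed

end

section \<open>The uncertainty inequality\<close>

locale ahlfors_regular_resistance_form =
  resistance_metric_form M E D + ahlfors_regular M b C\<^sub>1 C\<^sub>2
  for M :: "'a::metric_space measure" and E D b C\<^sub>1 C\<^sub>2
begin

text \<open>Zero energy would force \<open>v\<close> to be constant, and a nonzero constant is not
  square integrable because the volume of balls is unbounded.\<close>

lemma energy_pos:
  assumes v: "v \<in> D" "continuous_on UNIV v"
    and one: "(\<integral>\<^sup>+x. ennreal ((v x)\<^sup>2) \<partial>M) = 1"
  shows "0 < E v v"
proof (rule ccontr)
  assume "\<not> 0 < E v v"
  then have E0: "E v v = 0" using form_nonneg[OF v(1)] by simp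
  define c where "c = v undefined"
  have const: "v x = c" for x
    using diff_square_le[OF v, of x undefined] E0 by (simp add: c_def)
  have c: "c \<noteq> 0" using one const by auto
  have "c\<^sup>2 * (C\<^sub>1 * r powr b) \<le> 1" if r: "0 < r" for r
  proof -
    have "ennreal (c\<^sup>2 * (C\<^sub>1 * r powr b)) \<le> ennreal (c\<^sup>2) * emeasure M (ball undefined r)"
      using C1_pos ball_lower[OF r] by (simp add: ennreal_mult mult_left_mono)
    also have "\<dots> \<le> ennreal (c\<^sup>2) * emeasure M (space M)"
      by (intro mult_left_mono emeasure_space) simp
    also have "\<dots> = (\<integral>\<^sup>+x. ennreal ((v x)\<^sup>2) \<partial>M)" by (simp add: const)
    finally show ?thesis using one by simp
  qed
  \<comment> \<open>At this radius the left side equals 2.\<close>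
  from this[of "(2 / (c\<^sup>2 * C\<^sub>1)) powr (1/b)"] show False
    using c C1_pos b_pos by (simp add: powr_powr)
qed

lemma concentrated_energy_bound:
  assumes v: "v \<in> D" "continuous_on UNIV v"
    and one: "(\<integral>\<^sup>+x. ennreal ((v x)\<^sup>2) \<partial>M) = 1"
    and R: "0 < R"
    and half: "ennreal (1/2) \<le> (\<integral>\<^sup>+x. ennreal ((v x)\<^sup>2) * indicator (ball x\<^sub>0 R) x \<partial>M)"
  shows "1 / (64 * C\<^sub>2 * (1 + (32 * C\<^sub>2 / C\<^sub>1) powr (1/b))) \<le> R powr (b + 1) * E v v"
proof -
  \<comment> \<open>\<open>L\<close> is chosen so that a ball of radius \<open>L * R\<close> has
    volume at least \<open>32 * \<beta>\<close>, where \<open>\<beta>\<close> bounds the volume of a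
    ball of radius \<open>R\<close> from above.\<close>
  define L where "L = (32 * C\<^sub>2 / C\<^sub>1) powr (1/b)"
  define \<beta> where "\<beta> = C\<^sub>2 * R powr b"
  have \<beta>: "0 < \<beta>" using C2_pos R by (simp add: \<beta>_def)
  have L: "0 < L" "C\<^sub>1 * L powr b = 32 * C\<^sub>2"
    using C1_pos C2_pos b_pos by (simp_all add: L_def powr_powr)
  \<comment> \<open>Otherwise the mass in \<open>ball x\<^sub>0 R\<close> would be at most 1/4,
    against the assumed 1/2.\<close>
  obtain x where x: "dist x\<^sub>0 x < R" "1 / (4 * \<beta>) \<le> (v x)\<^sup>2"
  proof (rule ccontr)
    assume "\<not> thesis"
    with that have small: "(v x)\<^sup>2 \<le> 1 / (4 * \<beta>)" if "x \<in> ball x\<^sub>0 R" for x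
      using that by force
    have "ennreal (1/2) \<le> (\<integral>\<^sup>+x. ennreal (1 / (4 * \<beta>)) * indicator (ball x\<^sub>0 R) x \<partial>M)"
      using half by (rule order_trans)
        (auto intro!: nn_integral_mono simp: small ennreal_leI split: split_indicator)
    also have "\<dots> = ennreal (1 / (4 * \<beta>)) * emeasure M (ball x\<^sub>0 R)"
      by (simp add: nn_integral_cmult_indicator)
    also have "\<dots> \<le> ennreal (1 / (4 * \<beta>)) * ennreal \<beta>"
      using ball_upper[OF R, of x\<^sub>0] unfolding \<beta>_def by (intro mult_left_mono) auto
    also have "\<dots> = ennreal (1/4)" using \<beta> by (simp flip: ennreal_mult)
    finally show False by (subst (asm) ennreal_le_iff) simp_all
  qed
  \<comment> \<open>Otherwise the total mass would be at least 32/16 = 2. The threshold is a quarter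
    of the one for \<open>x\<close>, so that \<open>v y\<close> is at most half of
    \<open>v x\<close> in absolute value.\<close>
  obtain y where y: "dist x\<^sub>0 y < L * R" "(v y)\<^sup>2 \<le> 1 / (16 * \<beta>)"
  proof (rule ccontr)
    assume "\<not> thesis"
    with that have large: "1 / (16 * \<beta>) \<le> (v y)\<^sup>2" if "y \<in> ball x\<^sub>0 (L * R)" for y
      using that by force
    have LR: "0 < L * R" using L(1) R by simp
    have "C\<^sub>1 * (L * R) powr b = 32 * \<beta>"
      using L R by (simp add: powr_mult \<beta>_def flip: mult.assoc)
    then have m: "ennreal (32 * \<beta>) \<le> emeasure M (ball x\<^sub>0 (L * R))"
      using ball_lower[OF LR] by metis
    have "ennreal 2 = ennreal (1 / (16 * \<beta>)) * ennreal (32 * \<beta>)"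
      using \<beta> by (simp flip: ennreal_mult)
    also have "\<dots> \<le> ennreal (1 / (16 * \<beta>)) * emeasure M (ball x\<^sub>0 (L * R))"
      using m by (intro mult_left_mono) auto
    also have "\<dots> = (\<integral>\<^sup>+y. ennreal (1 / (16 * \<beta>)) * indicator (ball x\<^sub>0 (L * R)) y \<partial>M)"
      by (simp add: nn_integral_cmult_indicator)
    also have "\<dots> \<le> (\<integral>\<^sup>+y. ennreal ((v y)\<^sup>2) \<partial>M)"
      by (auto intro!: nn_integral_mono simp: large ennreal_leI split: split_indicator)
    finally show False using one by simp
  qed
  have "(2 * \<bar>v y\<bar>)\<^sup>2 \<le> \<bar>v x\<bar>\<^sup>2" using x(2) y(2) by (simp add: power_mult_distrib)
  then have "2 * \<bar>v y\<bar> \<le> \<bar>v x\<bar>" by (rule power2_le_imp_le) simp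
  then have "\<bar>v x\<bar> / 2 \<le> \<bar>v x - v y\<bar>" by linarith
  then have "(\<bar>v x\<bar> / 2)\<^sup>2 \<le> \<bar>v x - v y\<bar>\<^sup>2" by (rule power_mono) simp
  then have "1 / (16 * \<beta>) \<le> (v x - v y)\<^sup>2" using x(2) by (simp add: power_divide)
  also have "\<dots> \<le> 4 * dist x y * E v v" by (rule diff_square_le[OF v])
  also have "\<dots> \<le> 4 * ((1 + L) * R) * E v v"
  proof -
    have "dist x y \<le> (1 + L) * R"
      using dist_triangle3[of x y x\<^sub>0] x(1) y(1) by (simp add: algebra_simps)
    then show ?thesis using form_nonneg[OF v(1)] by (intro mult_right_mono) auto
  qed
  \<comment> \<open>The 64 is 16 from the gap between the two values times 4 from
    \<open>diff_square_le\<close>.\<close>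
  finally have "1 \<le> 64 * C\<^sub>2 * (1 + L) * (R powr b * R * E v v)"
    using \<beta> by (simp add: pos_divide_le_eq \<beta>_def ac_simps)
  moreover have "R powr b * R = R powr (b + 1)" using R by (simp add: powr_add)
  moreover have "0 < 64 * C\<^sub>2 * (1 + L)" using C2_pos L(1) by simp
  ultimately show ?thesis unfolding L_def[symmetric]
    by (simp add: pos_divide_le_eq mult.commute)
qed

text \<open>The variance is kept for \<open>u\<close>, since \<open>concentration\<close> needs only
  measurability. Only the energy and the masses of balls pass to the continuous version
  \<open>v\<close>, where pointwise estimates make sense.\<close>

lemma uncertainty:
  assumes cont: "has_continuous_versions M D"
    and u: "u \<in> D" "l2_norm M u = 1"
  shows "ennreal (1 / (128 * C\<^sub>2 * (1 + (32 * C\<^sub>2 / C\<^sub>1) powr (1/b))))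
    \<le> spatial_variance M (b + 1) u * energy E D u" (is "ennreal ?C \<le> _")
proof -
  have L2: "u \<in> borel_measurable M" "integrable M (\<lambda>x. (u x)\<^sup>2)"
    using u(1) domain_subset by (auto simp: L2_def)
  have one_u: "(\<integral>\<^sup>+x. ennreal ((u x)\<^sup>2) \<partial>M) = 1"
    using u(2) L2(2) by (simp add: nn_integral_eq_integral l2_norm_def)
  obtain v where v: "continuous_on UNIV v" and ae: "AE x in M. u x = v x"
    using cont u(1) by (auto simp: has_continuous_versions_def)
  have [measurable]: "v \<in> borel_measurable M" using v by (rule continuous_measurable)
  have "integrable M (\<lambda>x. (v x)\<^sup>2)"
    by (rule integrable_cong_AE_imp[OF L2(2)]) (use ae in \<open>auto elim!: eventually_mono\<close>)
  then have vD: "v \<in> D" using domain_AE[OF u(1) _ ae] by (simp add: L2_def)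
  \<comment> \<open>\<open>form_AE\<close> changes the first argument only, so symmetry is used to
    change both.\<close>
  have Euv: "E u u = E v v"
    using form_AE[OF u(1) vD u(1) ae] form_AE[OF u(1) vD vD ae] form_sym[OF u(1) vD] by simp
  have mass: "(\<integral>\<^sup>+x. ennreal ((u x)\<^sup>2) * indicator A x \<partial>M) =
      (\<integral>\<^sup>+x. ennreal ((v x)\<^sup>2) * indicator A x \<partial>M)" for A
    by (rule nn_integral_cong_AE) (use ae in \<open>auto elim!: eventually_mono\<close>)
  have one_v: "(\<integral>\<^sup>+x. ennreal ((v x)\<^sup>2) \<partial>M) = 1" using mass[of UNIV] one_u by simp
  have pos: "0 < E v v" by (rule energy_pos[OF vD v one_v])
  \<comment> \<open>A \<open>V\<close> strictly above the variance is positive and gives the strict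
    inequality at the centre. The constant 128 is twice 64 because
    \<open>R powr (b + 1) = 2 * V\<close>.\<close>
  have bound: "?C \<le> V * E v v"
    if V: "0 < V" "spatial_variance M (b + 1) u < ennreal V" for V
  proof -
    define R where "R = (2 * V) powr (1 / (b + 1))"
    have R: "0 < R" "R powr (b + 1) = 2 * V" using V(1) b_pos by (simp_all add: R_def powr_powr)
    obtain x\<^sub>0 where
      "ennreal (1/2) \<le> (\<integral>\<^sup>+x. ennreal ((u x)\<^sup>2) * indicator (ball x\<^sub>0 R) x \<partial>M)"
      using concentration[OF L2(1) one_u V R] b_pos by auto
    then have "1 / (64 * C\<^sub>2 * (1 + (32 * C\<^sub>2 / C\<^sub>1) powr (1/b))) \<le> R powr (b + 1) * E v v"
      unfolding mass by (rule concentrated_energy_bound[OF vD v one_v R(1)])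
    then have "1 / (64 * C\<^sub>2 * (1 + (32 * C\<^sub>2 / C\<^sub>1) powr (1/b))) / 2 \<le> 2 * V * E v v / 2"
      unfolding R(2) by (rule divide_right_mono) simp
    then show ?thesis by (simp add: algebra_simps)
  qed
  have energy: "energy E D u = ennreal (E v v)" using u(1) Euv by (simp add: energy_def)
  show ?thesis
  proof (cases "spatial_variance M (b + 1) u")
    case (real s)
    \<comment> \<open>Let \<open>V\<close> decrease to the variance \<open>s\<close>: if this
      failed, some \<open>V\<close> above \<open>s\<close> would violate
      \<open>bound\<close>.\<close>
    have "?C \<le> s * E v v"
    proof (rule ccontr)
      assume "\<not> ?C \<le> s * E v v"
      then have "s < ?C / E v v" by (simp only: not_le pos_less_divide_eq[OF pos])
      then obtain V where V: "s < V" "V < ?C / E v v" using dense by blast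
      have "?C \<le> V * E v v" using real V(1) by (intro bound) (auto simp: ennreal_lessI)
      moreover have "V * E v v < ?C" using V(2) by (simp only: pos_less_divide_eq[OF pos])
      ultimately show False by (rule leD[THEN notE])
    qed
    then show ?thesis unfolding real(2) energy
      using real(1) pos by (simp add: ennreal_leI flip: ennreal_mult)
  next
    case top
    \<comment> \<open>In \<open>ennreal\<close> the product of infinity and 0 is 0, so positivity of
      the energy is essential here.\<close>
    then show ?thesis using pos by (simp add: energy ennreal_top_mult)
  qed
qed

end

theorem theorem1:
  fixes \<mu> :: "'a::metric_space measure"
    and \<E> :: "('a \<Rightarrow> real) \<Rightarrow> ('a \<Rightarrow> real) \<Rightarrow> real"
    and Dom :: "('a \<Rightarrow> real) set"
    and b C\<^sub>1 C\<^sub>2 \<gamma> :: real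
  assumes "sets \<mu> = sets borel"
    and "dirichlet_form \<mu> \<E> Dom"
    and "\<And>x y. ennreal (dist x y) = effective_resistance \<E> Dom x y"
    and "has_continuous_versions \<mu> Dom"
    and "b > 0" and "C\<^sub>1 > 0" and "C\<^sub>2 > 0"
    and "\<And>x r. r > 0 \<Longrightarrow> ennreal (C\<^sub>1 * r powr b) \<le> emeasure \<mu> (ball x r)
                     \<and> emeasure \<mu> (ball x r) \<le> ennreal (C\<^sub>2 * r powr b)"
    and "\<gamma> = b + 1"
  shows "\<exists>C::real. C > 0 \<and>
    (\<forall>u\<in>Dom. l2_norm \<mu> u = 1 \<longrightarrow> spatial_variance \<mu> \<gamma> u * energy \<E> Dom u \<ge> ennreal C)"
  proof -
  interpret ahlfors_regular_resistance_form \<mu> \<E> Dom b C\<^sub>1 C\<^sub>2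
    using assms by (intro ahlfors_regular_resistance_form.intro resistance_metric_form.intro
        resistance_metric_form_axioms.intro ahlfors_regular.intro) auto
  let ?C = "1 / (128 * C\<^sub>2 * (1 + (32 * C\<^sub>2 / C\<^sub>1) powr (1/b)))"
  have "0 < ?C" using C2_pos by (simp add: add_pos_nonneg)
  then show ?thesis
    using uncertainty[OF assms(4)] unfolding \<open>\<gamma> = b + 1\<close> by (intro exI[of _ ?C]) simp
qed

end
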